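(* For every $n\ge 1$ and every permutation $\pi$ of $[n]$, we have $pbid(\pi)\le g(\pi)$.
   Context: Permutations of $[n]=\{1,\dots,n\}$ are written as sequences $\pi=\langle\pi_1\,\pi_2\cdots\pi_n\rangle$ with $\pi_i=\pi(i)$; products are compositions applied right to left, so $(\pi\sigma)_i=\pi_{\sigma(i)}$; $\iota=\langle 1\,2\cdots n\rangle$ is the identity. For $1\le i<j\le k<\ell\le n+1$, the block-interchange $\beta(i,j,k,\ell)$ is the permutation $\langle 1\cdots i-1\;\; k\cdots \ell-1\;\; j\cdots k-1\;\; i\cdots j-1\;\; \ell\cdots n\rangle$, so that $\pi\beta(i,j,k,\ell)$ is obtained from $\pi$ by exchanging the blocks $\pi_i\cdots\pi_{j-1}$ and $\pi_k\cdots\pi_{\ell-1}$. A prefix block-interchange is a block-interchange with $i=1$. $pbid(\pi)$ denotes the minimum $t\ge 0$ such that there are prefix block-interchanges $\beta_1,\dots,\beta_t$ with $\pi\beta_1\cdots\beta_t=\iota$. Breakpoint graph: let $\pi'=(\pi'_0,\dots,\pi'_{2n+1})$ with $\pi'_0=0$, $\pi'_{2n+1}=2n+1$ and $(\pi'_{2i-1},\pi'_{2i})=(2\pi_i-1,2\pi_i)$ for $1\le i\le n$. $G(\pi)$ is the graph on vertex set $\{0,\dots,2n+1\}$ (vertex $\pi'_p$ being at position $p$) with black edges $\{\pi'_{2i},\pi'_{2i+1}\}$ for $0\le i\le n$ and grey edges $\{2i,2i+1\}$ for $0\le i\le n$. It decomposes uniquely into edge-disjoint cycles alternating black and grey edges;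 the length of a cycle is its number of black edges, a $k$-cycle is a cycle of length $k$. $c(G(\pi))$ is the number of cycles and $c_k(G(\pi))$ the number of $k$-cycles. Let $f(\pi)=0$ if $\pi_1=1$ and $f(\pi)=1$ otherwise, and $g(\pi)=\frac{n+1+c(G(\pi))}{2}-c_1(G(\pi))-f(\pi)$. *)

theory Defs
  imports Complex_Main "HOL-Combinatorics.Permutations"
begin

text \<open>
  A permutation of \<open>[n]\<close> is a function \<open>p\<close> with \<open>p permutes {1..n}\<close>, so it is the identity
  outside \<open>{1..n}\<close> and \<open>p \<circ> q\<close> is the right-to-left product.
\<close>

section \<open>Prefix block-interchanges\<close>

definition of_one_line :: "nat list \<Rightarrow> nat \<Rightarrow> nat" where
  "of_one_line xs m = (if 1 \<le> m \<and> m \<le> length xs then xs ! (m - 1) else m)"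

definition block_interchange :: "nat \<Rightarrow> nat \<Rightarrow> nat \<Rightarrow> nat \<Rightarrow> nat \<Rightarrow> nat \<Rightarrow> nat" where
  "block_interchange n i j k l =
     of_one_line ([1..<i] @ [k..<l] @ [j..<k] @ [i..<j] @ [l..<n+1])"

definition is_block_interchange :: "nat \<Rightarrow> nat \<Rightarrow> (nat \<Rightarrow> nat) \<Rightarrow> bool" where
  "is_block_interchange n i b \<longleftrightarrow>
     (\<exists>j k l. 1 \<le> i \<and> i < j \<and> j \<le> k \<and> k < l \<and> l \<le> n + 1 \<and> b = block_interchange n i j k l)"

abbreviation is_prefix_block_interchange :: "nat \<Rightarrow> (nat \<Rightarrow> nat) \<Rightarrow> bool" where
  "is_prefix_block_interchange n \<equiv> is_block_interchange n 1"

definition sorts :: "nat \<Rightarrow> (nat \<Rightarrow> nat) \<Rightarrow> (nat \<Rightarrow> nat) list \<Rightarrow> bool" where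
  "sorts n p bs \<longleftrightarrow>
     (\<forall>b\<in>set bs. is_prefix_block_interchange n b) \<and> foldl (\<circ>) p bs = id"

definition pbid :: "nat \<Rightarrow> (nat \<Rightarrow> nat) \<Rightarrow> nat" where
  "pbid n p = (LEAST t. \<exists>bs. length bs = t \<and> sorts n p bs)"

text \<open>
  The minimum in \<open>pbid\<close> is over a nonempty set (lemma \<open>ex_sorts\<close>): \<open>\<beta>(1,2,m,m+1)\<close> exchanges
  the positions 1 and \<open>m\<close>, and these transpositions generate all permutations of \<open>[n]\<close>.
\<close>

lemma block_interchange_transpose:
  assumes "2 \<le> m" "m \<le> n"
  shows "block_interchange n 1 2 m (Suc m) = transpose 1 m"
proof
  fix x
  let ?xs = "m # [2..<m] @ 1 # [Suc m..<n + 1]"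
  have xs: "block_interchange n 1 2 m (Suc m) = of_one_line ?xs"
    using assms by (simp add: block_interchange_def numeral_2_eq_2)
  have len: "length ?xs = n"
    using assms by (cases "m = n") auto
  consider "x = 0" | "x = 1" | "1 < x" "x < m" | "x = m" | "m < x" "x \<le> n" | "n < x"
    by linarith
  then have "of_one_line ?xs x = transpose 1 m x"
  proof cases
    case 3
    then have "x - Suc (Suc 0) < m - 2" "Suc (Suc (x - Suc (Suc 0))) = x"
      by linarith+
    with 3 have "?xs ! (x - 1) = x"
      by (simp add: nth_Cons' nth_append)
    then show ?thesis using 3 assms len by (simp add: of_one_line_def transpose_def)
  next
    case 4
    then have "?xs ! (x - 1) = 1"
      using assms by (simp add: nth_Cons' nth_append numeral_2_eq_2)
    then show ?thesis using 4 assms len by (simp add: of_one_line_def transpose_def)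
  next
    case 5
    then have "x - 1 = length (m # [2..<m] @ [1]) + (x - Suc m)"
      using assms by simp
    then have "?xs ! (x - 1) = [Suc m..<n + 1] ! (x - Suc m)"
      using nth_append_length_plus[of "m # [2..<m] @ [1]" "[Suc m..<n + 1]" "x - Suc m"] by simp
    also have "\<dots> = x"
      using 5 by (subst nth_upt) auto
    finally have "?xs ! (x - 1) = x" .
    then show ?thesis using 5 assms len by (simp add: of_one_line_def transpose_def)
  qed (use assms len in \<open>simp_all add: of_one_line_def transpose_def\<close>)
  with xs show "block_interchange n 1 2 m (Suc m) x = transpose 1 m x" by simp
qed

lemma foldl_comp: "foldl (\<circ>) p bs = p \<circ> foldl (\<circ>) id bs"
  by (induction bs rule: rev_induct) (auto simp: comp_assoc)

lemma transpose_product: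
  assumes "a \<in> {1..n}" "b \<in> {1..n}" "a \<noteq> b"
  shows "\<exists>bs. (\<forall>\<beta>\<in>set bs. is_prefix_block_interchange n \<beta>) \<and> foldl (\<circ>) id bs = transpose a b"
proof -
  have pre: "is_prefix_block_interchange n (transpose 1 m)" if "m \<in> {1..n}" "m \<noteq> 1" for m
  proof -
    have "transpose 1 m = block_interchange n 1 2 m (Suc m)"
      using that block_interchange_transpose[of m n] by simp
    then show ?thesis
      using that unfolding is_block_interchange_def
      by (intro exI[of _ 2] exI[of _ m] exI[of _ "Suc m"]) auto
  qed
  consider "a = 1" | "b = 1" | "a \<noteq> 1" "b \<noteq> 1" by blast
  then show ?thesis
  proof cases
    case 1
    then show ?thesis using pre[of b] assms by (intro exI[of _ "[transpose 1 b]"]) auto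
  next
    case 2
    then show ?thesis using pre[of a] assms
      by (intro exI[of _ "[transpose 1 a]"]) (auto simp: transpose_commute)
  next
    case 3
    have "transpose 1 a \<circ> transpose 1 b \<circ> transpose 1 a = transpose a b"
      using 3 assms by (auto simp: fun_eq_iff transpose_def)
    then show ?thesis using pre[of a] pre[of b] 3 assms
      by (intro exI[of _ "[transpose 1 a, transpose 1 b, transpose 1 a]"]) auto
  qed
qed

lemma ex_sorts:
  assumes "p permutes {1..n}"
  shows "\<exists>bs. sorts n p bs"
proof -
  have prod: "\<exists>bs. (\<forall>\<beta>\<in>set bs. is_prefix_block_interchange n \<beta>) \<and> foldl (\<circ>) id bs = q"
    if "q permutes {1..n}" for q
    using finite_atLeastAtMost that
  proof (induction rule: permutes_rev_induct)
    case id
    show ?case by (intro exI[of _ "[]"]) auto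
  next
    case (swap a b q)
    show ?case
    proof (cases "a = b")
      case True
      then show ?thesis using swap by auto
    next
      case False
      from swap.IH obtain bs where bs: "\<forall>\<beta>\<in>set bs. is_prefix_block_interchange n \<beta>"
          "foldl (\<circ>) id bs = q" by blast
      from transpose_product[OF swap.hyps(1,2) False] obtain cs
        where cs: "\<forall>\<beta>\<in>set cs. is_prefix_block_interchange n \<beta>"
          "foldl (\<circ>) id cs = transpose a b" by blast
      have "foldl (\<circ>) id (bs @ cs) = q \<circ> transpose a b"
        using bs(2) cs(2) foldl_comp[of q cs] by simp
      moreover have "\<forall>\<beta>\<in>set (bs @ cs). is_prefix_block_interchange n \<beta>"
        using bs(1) cs(1) by auto
      ultimately show ?thesis by blast
    qed
  qed
  from prod[OF permutes_inv[OF assms]] obtain bs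
    where "\<forall>\<beta>\<in>set bs. is_prefix_block_interchange n \<beta>" "foldl (\<circ>) id bs = inv p" by blast
  then show ?thesis
    using foldl_comp[of p bs] permutes_inv_o(1)[OF assms] unfolding sorts_def by auto
qed

section \<open>The breakpoint graph\<close>

definition extended :: "nat \<Rightarrow> (nat \<Rightarrow> nat) \<Rightarrow> nat \<Rightarrow> nat" where
  "extended n p q =
     (if q = 0 then 0
      else if q = 2 * n + 1 then 2 * n + 1
      else if odd q then 2 * p ((q + 1) div 2) - 1
      else 2 * p (q div 2))"

text \<open>
  Edges carry their colour, since a black and a grey edge may be parallel: they then form a
  1-cycle. The vertex set \<open>{0..2 * n + 1}\<close> is implicit, as every vertex is incident to an edge.
\<close>

datatype colour = Black | Grey

type_synonym edge = "colour \<times> nat set"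

definition breakpoint_graph :: "nat \<Rightarrow> (nat \<Rightarrow> nat) \<Rightarrow> edge set" where
  "breakpoint_graph n p =
     {(Black, {extended n p (2 * i), extended n p (2 * i + 1)}) | i. i \<le> n} \<union>
     {(Grey, {2 * i, 2 * i + 1}) | i. i \<le> n}"

text \<open>
  The edges of the closed walk \<open>vs ! 0, vs ! 1, \<dots>, vs ! (2 * k - 1), vs ! 0\<close>, where
  \<open>length vs = 2 * k\<close>, coloured alternately black and grey.
\<close>

definition alternating_edges :: "nat list \<Rightarrow> edge set" where
  "alternating_edges vs =
     {(Black, {vs ! (2 * i), vs ! (2 * i + 1)}) | i. 2 * i < length vs} \<union>
     {(Grey, {vs ! (2 * i + 1), vs ! ((2 * i + 2) mod length vs)}) | i. 2 * i < length vs}"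

text \<open>
  A cycle is identified with its set of edges, so that it does not depend on a starting vertex or
  a direction. Every vertex of a breakpoint graph lies on exactly one black and one grey edge,
  so the cycles of the unique decomposition are exactly all alternating cycles of the graph.
\<close>

definition alternating_cycles :: "edge set \<Rightarrow> edge set set" where
  "alternating_cycles G =
     {C. C \<subseteq> G \<and>
        (\<exists>vs. vs \<noteq> [] \<and> even (length vs) \<and> distinct vs \<and> C = alternating_edges vs)}"

definition cycle_length :: "edge set \<Rightarrow> nat" where
  "cycle_length C = card {e \<in> C. fst e = Black}"

definition num_cycles :: "edge set \<Rightarrow> nat" where
  "num_cycles G = card (alternating_cycles G)"

definition num_k_cycles :: "nat \<Rightarrow> edge set \<Rightarrow> nat" where
  "num_k_cycles k G = card {C \<in> alternating_cycles G. cycle_length C = k}"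

definition f_term :: "(nat \<Rightarrow> nat) \<Rightarrow> nat" where
  "f_term p = (if p 1 = 1 then 0 else 1)"

definition g_bound :: "nat \<Rightarrow> (nat \<Rightarrow> nat) \<Rightarrow> real" where
  "g_bound n p = (real n + 1 + real (num_cycles (breakpoint_graph n p))) / 2
     - real (num_k_cycles 1 (breakpoint_graph n p)) - real (f_term p)"

end

theory Submission
  imports Defs "HOL-Combinatorics.Orbits"
begin

text \<open>
  Number the black edges \<open>0, \<dots>, n\<close> from left to right, and let \<open>\<sigma>\<close> send a black edge to the one
  reached from its right end along a grey edge. With \<open>s\<close> the cyclic shift of \<open>{0..n}\<close> and
  \<open>p 0 = 0\<close>, we have \<open>\<sigma> = p\<inverse> s\<inverse> p s\<close>; the cycles of \<open>G(p)\<close> are the orbits of \<open>\<sigma>\<close>, the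
  1-cycles its fixed points, and \<open>p 1 = 1\<close> iff \<open>\<sigma> 0 = 0\<close>. Up to conjugation, a prefix
  block-interchange multiplies \<open>\<sigma>\<close> on the right by \<open>(0 b)(a c)\<close> with \<open>0 < a < b < c\<close>, or by the
  3-cycle \<open>0 \<mapsto> b \<mapsto> c \<mapsto> 0\<close> with \<open>0 < b < c\<close>. Each \<open>p \<noteq> id\<close> admits such a move lowering \<open>g\<close> by at
  least 1. If \<open>\<sigma> 0 = 0\<close>, take \<open>c\<close> with \<open>b = \<sigma> c < c\<close>: the 3-cycle makes \<open>b\<close> fixed and merges \<open>0\<close>
  into the cycle of \<open>c\<close>. If \<open>\<sigma> 0 = b \<noteq> 0\<close>, some \<open>x \<ge> b\<close> has \<open>0 < \<sigma> x < b\<close>, and a move makes both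
  \<open>b\<close> and \<open>\<sigma> x\<close> fixed.
\<close>

section \<open>Cycles of a permutation\<close>

definition num_orbits :: "'a set \<Rightarrow> ('a \<Rightarrow> 'a) \<Rightarrow> nat" where
  "num_orbits S \<sigma> = card (orbit \<sigma> ` S)"

definition fixed_points :: "'a set \<Rightarrow> ('a \<Rightarrow> 'a) \<Rightarrow> 'a set" where
  "fixed_points S \<sigma> = {x \<in> S. \<sigma> x = x}"

lemma permutes_self_in_orbit:
  assumes "\<sigma> permutes S" "finite S"
  shows "x \<in> orbit \<sigma> x"
  using assms by (metis permutation_permutes permutation_self_in_orbit)

lemma permutes_orbit_eq:
  assumes "\<sigma> permutes S" "finite S" "y \<in> orbit \<sigma> x"
  shows "orbit \<sigma> y = orbit \<sigma> x"
  using cyclic_on_orbit[OF assms(1,2)] assms(3) by (rule orbit_cyclic_eq3)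

text \<open>Composing with the transposition makes \<open>y\<close> a fixed point and sends
  \<open>x\<close> straight to \<open>\<sigma> y\<close>, so every other orbit walk merely skips
  \<open>y\<close>.\<close>

lemma orbit_split:
  assumes \<sigma>: "\<sigma> permutes S" "finite S" and xy: "\<sigma> x = y" "x \<noteq> y" and "z \<noteq> y"
  shows "orbit (\<sigma> \<circ> transpose x y) z = orbit \<sigma> z - {y}"
proof -
  define \<tau> where "\<tau> = \<sigma> \<circ> transpose x y"
  have inj: "\<sigma> u = \<sigma> v \<longleftrightarrow> u = v" for u v
    using permutes_inj[OF \<sigma>(1)] by (simp add: inj_eq)
  have y: "\<sigma> u = y \<longleftrightarrow> u = x" for u
    using inj[of u x] xy by simp
  have \<tau>x: "\<tau> x = \<sigma> y" and \<tau>: "\<And>u. u \<noteq> x \<Longrightarrow> u \<noteq> y \<Longrightarrow> \<tau> u = \<sigma> u"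
    by (auto simp: \<tau>_def transpose_def)
  have "x \<in> S"
    using xy permutes_not_in[OF \<sigma>(1), of x] by auto
  then have "y \<in> S"
    using xy permutes_in_image[OF \<sigma>(1), of x] by simp
  with \<open>x \<in> S\<close> have "\<tau> permutes S"
    unfolding \<tau>_def using \<sigma>(1) by (intro permutes_compose permutes_swap_id)
  then have self: "z \<in> orbit \<tau> z"
    using \<sigma>(2) by (rule permutes_self_in_orbit)
  have "w \<in> orbit \<sigma> z - {y}" if "w \<in> orbit \<tau> z" for w
    using that
  proof induction
    case base
    show ?case
    proof (cases "z = x")
      case True
      with xy have "\<sigma> y \<in> orbit \<sigma> z"
        using orbit.step[OF orbit.base[of \<sigma> z]] by simp
      then show ?thesis
        using True \<tau>x y[of y] xy by auto
    next
      case False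
      then show ?thesis
        using \<tau>[of z] \<open>z \<noteq> y\<close> y[of z] by (auto intro: orbit.base)
    qed
  next
    case (step w)
    show ?case
    proof (cases "w = x")
      case True
      with step xy have "\<sigma> y \<in> orbit \<sigma> z"
        using orbit.step[OF orbit.step[of w \<sigma> z]] by auto
      then show ?thesis
        using True \<tau>x y[of y] xy by auto
    next
      case False
      then show ?thesis
        using \<tau>[of w] step y[of w] by (auto intro: orbit.step)
    qed
  qed
  \<comment> \<open>Induction along \<open>\<sigma>\<close>: while that walk visits
    \<open>y\<close>, the walk of the new permutation waits at \<open>x\<close>.\<close>
  moreover have "(w \<noteq> y \<longrightarrow> w \<in> orbit \<tau> z) \<and> (w = y \<longrightarrow> x \<in> orbit \<tau> z)"
    if "w \<in> orbit \<sigma> z" for w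
    using that
  proof induction
    case base
    show ?case
      using \<tau>[of z] y[of z] \<open>z \<noteq> y\<close> self orbit.base[of \<tau> z] xy(1) by (cases "z = x") simp_all
  next
    case (step w)
    show ?case
    proof (cases "w = y")
      case True
      with step have "\<tau> x \<in> orbit \<tau> z"
        by (auto intro: orbit.step)
      moreover have "\<tau> x = \<sigma> w" "\<sigma> w \<noteq> y"
        using True \<tau>x y[of y] xy by auto
      ultimately show ?thesis by simp
    next
      case False
      with step have "w \<in> orbit \<tau> z" "\<tau> w \<in> orbit \<tau> z"
        by (auto intro: orbit.step)
      then show ?thesis
        using False \<tau>[of w] y[of w] by (cases "w = x") auto
    qed
  qed
  ultimately show ?thesis unfolding \<tau>_def by blast
qed

text \<open>The point \<open>y\<close> becomes an orbit of its own and the old orbits only lose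
  \<open>y\<close>. The orbit of \<open>y\<close> also contains \<open>x\<close>, so none of them
  vanishes.\<close>

lemma num_orbits_split:
  assumes \<sigma>: "\<sigma> permutes S" "finite S" and x: "x \<in> S" and xy: "\<sigma> x = y" "x \<noteq> y"
  shows "num_orbits S (\<sigma> \<circ> transpose x y) = Suc (num_orbits S \<sigma>)"
proof -
  let ?\<tau> = "\<sigma> \<circ> transpose x y"
  have y: "y \<in> S" "y \<in> orbit \<sigma> x"
    using x xy permutes_in_image[OF \<sigma>(1)] orbit.base[of \<sigma> x] by auto
  have S: "insert y (S - {y}) = S"
    using y by auto
  have "orbit ?\<tau> y = {y}"
    using xy by (simp add: orbit_eq_singleton_iff)
  then have "orbit ?\<tau> ` S = insert {y} (orbit ?\<tau> ` (S - {y}))"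
    using image_insert[of "orbit ?\<tau>" y "S - {y}", unfolded S] by simp
  also have "orbit ?\<tau> ` (S - {y}) = (\<lambda>C. C - {y}) ` orbit \<sigma> ` (S - {y})"
    using orbit_split[OF \<sigma> xy] by (auto simp: image_image)
  also have orb_y: "orbit \<sigma> ` (S - {y}) = orbit \<sigma> ` S"
  proof -
    have "orbit \<sigma> y \<in> orbit \<sigma> ` (S - {y})"
      using permutes_orbit_eq[OF \<sigma> y(2)] x xy(2) by blast
    then show ?thesis
      using image_insert[of "orbit \<sigma>" y "S - {y}", unfolded S] by (simp add: insert_absorb)
  qed
  finally have img: "orbit ?\<tau> ` S = insert {y} ((\<lambda>C. C - {y}) ` orbit \<sigma> ` S)" .
  \<comment> \<open>Each orbit has a representative other than \<open>y\<close>; it survives the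
    removal and determines the orbit.\<close>
  have "inj_on (\<lambda>C. C - {y}) (orbit \<sigma> ` S)"
  proof (rule inj_onI)
    fix C D assume C: "C \<in> orbit \<sigma> ` S" and D: "D \<in> orbit \<sigma> ` S" and eq: "C - {y} = D - {y}"
    obtain u where u: "u \<noteq> y" "C = orbit \<sigma> u"
      using C unfolding orb_y[symmetric] by auto
    then have "u \<in> D"
      using permutes_self_in_orbit[OF \<sigma>, of u] eq by auto
    then show "C = D"
      using D u permutes_orbit_eq[OF \<sigma>] by auto
  qed
  moreover have "{y} \<notin> (\<lambda>C. C - {y}) ` orbit \<sigma> ` S"
    by auto
  ultimately show ?thesis
    using \<sigma>(2) unfolding num_orbits_def img by (simp add: card_image)
qed

text \<open>The conjugating bijection carries the orbits of \<open>\<sigma>\<close> onto those of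
  \<open>\<rho>\<close>.\<close>

lemma num_orbits_conj:
  assumes "\<sigma> permutes S" "finite S" "\<beta> permutes S" and conj: "\<beta> \<circ> \<sigma> = \<rho> \<circ> \<beta>"
  shows "num_orbits S \<rho> = num_orbits S \<sigma>"
proof -
  have "orbit \<rho> (\<beta> x) = \<beta> ` orbit \<sigma> x" for x
    using orbit_inverse[OF permutes_self_in_orbit[OF assms(1,2)], of x \<rho> \<beta>] conj
    by (auto simp: fun_eq_iff)
  then have "orbit \<rho> ` \<beta> ` S = image \<beta> ` orbit \<sigma> ` S"
    by (simp add: image_image)
  then show ?thesis
    unfolding num_orbits_def permutes_image[OF assms(3)]
    by (simp only:) (intro card_image inj_on_image permutes_inj_on[OF assms(3)])
qed

lemma card_fixed_points_conj:
  assumes "\<beta> permutes S" and conj: "\<beta> \<circ> \<sigma> = \<rho> \<circ> \<beta>"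
  shows "card (fixed_points S \<rho>) = card (fixed_points S \<sigma>)"
proof -
  have eq: "\<beta> (\<sigma> x) = \<rho> (\<beta> x)" for x
    using conj by (simp add: fun_eq_iff)
  have inj: "\<beta> u = \<beta> v \<longleftrightarrow> u = v" for u v
    using permutes_inj[OF assms(1)] by (simp add: inj_eq)
  have "fixed_points S \<rho> = {x \<in> \<beta> ` S. \<rho> x = x}"
    by (simp add: fixed_points_def permutes_image[OF assms(1)])
  also have "\<dots> = \<beta> ` fixed_points S \<sigma>"
    by (auto simp: fixed_points_def eq[symmetric] inj)
  finally have "fixed_points S \<rho> = \<beta> ` fixed_points S \<sigma>" .
  then show ?thesis
    by (simp add: card_image permutes_inj_on[OF assms(1)])
qed

section \<open>Alternating cycles and orbits\<close>

lemma in_alternating_edges: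
  assumes "m < k" "length vs = 2 * k"
  shows "(Black, {vs ! (2 * m), vs ! (2 * m + 1)}) \<in> alternating_edges vs"
    "(Grey, {vs ! (2 * m + 1), vs ! ((2 * m + 2) mod (2 * k))}) \<in> alternating_edges vs"
  using assms unfolding alternating_edges_def by auto

text \<open>
  Both orientations of an alternating cycle are covered by one argument, because exchanging \<open>L\<close>
  with \<open>R\<close> and \<open>\<sigma>\<close> with its inverse gives the same graph.
\<close>

locale alternating_graph =
  fixes L R :: "'a \<Rightarrow> nat" and S :: "'a set" and \<sigma> :: "'a \<Rightarrow> 'a"
  assumes inj_L: "inj L" and inj_R: "inj R" and L_neq_R: "L i \<noteq> R j"
    and permutes: "\<sigma> permutes S" and finite_S: "finite S"
begin

text \<open>From \<open>L i\<close> the black edge leads to \<open>R (\<sigma> i)\<close> and the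
  grey edge on to \<open>L (\<sigma> i)\<close>: one black and one grey step together apply
  \<open>\<sigma>\<close> once.\<close>

definition edges :: "'a set \<Rightarrow> edge set" where
  "edges A = (\<lambda>i. (Black, {L i, R (\<sigma> i)})) ` A \<union> (\<lambda>i. (Grey, {L i, R i})) ` A"

lemma doubleton_LR [simp]: "{L i, R j} = {L i', R j'} \<longleftrightarrow> i = i' \<and> j = j'"
  using inj_L inj_R L_neq_R by (metis doubleton_eq_iff injD)

lemma doubleton_L: "{L i, v} = {L i', R j'} \<longleftrightarrow> i = i' \<and> v = R j'"
  using inj_L inj_R L_neq_R by (metis doubleton_eq_iff injD)

lemma doubleton_R: "{R i, v} = {L i', R j'} \<longleftrightarrow> i = j' \<and> v = L i'"
  using inj_L inj_R L_neq_R by (metis doubleton_eq_iff injD)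

lemma Black_in_edges: "(Black, e) \<in> edges A \<longleftrightarrow> (\<exists>i\<in>A. e = {L i, R (\<sigma> i)})"
  by (auto simp: edges_def)

lemma Grey_in_edges: "(Grey, e) \<in> edges A \<longleftrightarrow> (\<exists>i\<in>A. e = {L i, R i})"
  by (auto simp: edges_def)

lemma inj_edges: "inj edges"
proof (rule injI)
  fix A B assume "edges A = edges B"
  then have "(Grey, {L i, R i}) \<in> edges A \<longleftrightarrow> (Grey, {L i, R i}) \<in> edges B" for i
    by simp
  then show "A = B"
    by (auto simp: Grey_in_edges)
qed

lemma cycle_length_edges: "cycle_length (edges A) = card A"
proof -
  have "{e \<in> edges A. fst e = Black} = (\<lambda>i. (Black, {L i, R (\<sigma> i)})) ` A"
    by (auto simp: edges_def)
  moreover have "inj_on (\<lambda>i. (Black, {L i, R (\<sigma> i)})) A"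
    by (auto intro: inj_onI)
  ultimately show ?thesis
    by (simp add: cycle_length_def card_image)
qed

lemma image_orbit: "\<sigma> ` orbit \<sigma> i = orbit \<sigma> i"
proof -
  have "\<sigma> ` orbit \<sigma> i = orbit \<sigma> (\<sigma> i)"
    by (rule orbit_inverse[OF permutes_self_in_orbit[OF permutes finite_S]]) simp
  then show ?thesis
    using permutes_orbit_eq[OF permutes finite_S orbit.base] by simp
qed

text \<open>Here \<open>k\<close> may be any positive period of \<open>i\<close>, since only the
  sets of edges are compared.\<close>

lemma alternating_edges_walk:
  assumes len: "length vs = 2 * k" "0 < k" and closed: "(\<sigma> ^^ k) i = i"
    and vs: "\<And>m. m < k \<Longrightarrow> vs ! (2 * m) = L ((\<sigma> ^^ m) i) \<and> vs ! (2 * m + 1) = R ((\<sigma> ^^ Suc m) i)"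
  shows "alternating_edges vs = edges (orbit \<sigma> i)"
proof -
  have orb: "orbit \<sigma> i = (\<lambda>m. (\<sigma> ^^ m) i) ` {..<k}"
    using orbit_altdef_bounded[OF closed len(2)] by auto
  \<comment> \<open>The grey edge after step \<open>m\<close> has index
    \<open>(\<sigma> ^^ Suc m) i\<close>, so the orbit is also enumerated with exponents moved by
    one.\<close>
  have "orbit \<sigma> i = \<sigma> ` orbit \<sigma> i"
    by (rule image_orbit[symmetric])
  also have "\<dots> = (\<lambda>m. (\<sigma> ^^ Suc m) i) ` {..<k}"
    unfolding orb by (simp add: image_image)
  finally have orb': "orbit \<sigma> i = (\<lambda>m. (\<sigma> ^^ Suc m) i) ` {..<k}" .
  have grey: "vs ! ((2 * m + 2) mod (2 * k)) = L ((\<sigma> ^^ Suc m) i)" if "m < k" for m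
  proof (cases "Suc m = k")
    case True
    then have "(2 * m + 2) mod (2 * k) = 0" by auto
    then show ?thesis using vs[OF len(2)] closed True by simp
  next
    case False
    with that have "(2 * m + 2) mod (2 * k) = 2 * Suc m" by simp
    then show ?thesis using vs[of "Suc m"] that False by simp
  qed
  have "alternating_edges vs =
      (\<lambda>m. (Black, {vs ! (2 * m), vs ! (2 * m + 1)})) ` {..<k} \<union>
      (\<lambda>m. (Grey, {vs ! (2 * m + 1), vs ! ((2 * m + 2) mod (2 * k))})) ` {..<k}"
    unfolding alternating_edges_def len by auto
  also have "(\<lambda>m. (Black, {vs ! (2 * m), vs ! (2 * m + 1)})) ` {..<k} =
      (\<lambda>i. (Black, {L i, R (\<sigma> i)})) ` orbit \<sigma> i"
    unfolding orb image_image using vs by (intro image_cong) auto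
  also have "(\<lambda>m. (Grey, {vs ! (2 * m + 1), vs ! ((2 * m + 2) mod (2 * k))})) ` {..<k} =
      (\<lambda>i. (Grey, {L i, R i})) ` orbit \<sigma> i"
    unfolding orb' image_image using vs grey by (intro image_cong) auto
  finally show ?thesis by (simp add: edges_def)
qed

lemma edges_orbit_in_alternating_cycles:
  assumes "i \<in> S"
  shows "edges (orbit \<sigma> i) \<in> alternating_cycles (edges S)"
proof -
  \<comment> \<open>The least positive period of \<open>i\<close>; minimality makes the vertices of
    the walk distinct.\<close>
  define k where "k = funpow_dist1 \<sigma> i i"
  let ?v = "\<lambda>j. if even j then L ((\<sigma> ^^ (j div 2)) i) else R ((\<sigma> ^^ Suc (j div 2)) i)"
  let ?vs = "map ?v [0..<2 * k]"
  have self: "i \<in> orbit \<sigma> i"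
    using permutes finite_S by (rule permutes_self_in_orbit)
  have "0 < k"
    by (simp add: k_def)
  have closed: "(\<sigma> ^^ k) i = i"
    unfolding k_def using self by (rule funpow_dist1_prop)
  have inj: "m = m'" if "(\<sigma> ^^ m) i = (\<sigma> ^^ m') i" "m < k" "m' < k" for m m'
    using funpow_neq_less_funpow_dist1[OF self that(2,3)[unfolded k_def]] that(1) by blast
  have inj': "m = m'" if "(\<sigma> ^^ Suc m) i = (\<sigma> ^^ Suc m') i" "m < k" "m' < k" for m m'
    using that inj[of m m'] permutes_inj[OF permutes] by (simp add: inj_eq)
  have "inj_on ?v {0..<2 * k}"
  proof (rule inj_onI)
    fix j j' assume j: "j \<in> {0..<2 * k}" "j' \<in> {0..<2 * k}" "?v j = ?v j'"
    have b: "j div 2 < k" "j' div 2 < k"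
      using j by auto
    have par: "even j \<longleftrightarrow> even j'"
      using j(3) L_neq_R by (metis (full_types))
    have "j div 2 = j' div 2"
    proof (cases "even j")
      case True
      with j(3) par have "(\<sigma> ^^ (j div 2)) i = (\<sigma> ^^ (j' div 2)) i"
        using inj_L by (simp add: inj_eq)
      then show ?thesis using inj b by blast
    next
      case False
      with j(3) par have "(\<sigma> ^^ Suc (j div 2)) i = (\<sigma> ^^ Suc (j' div 2)) i"
        using inj_R by (simp add: inj_eq)
      then show ?thesis using inj' b by blast
    qed
    with par show "j = j'"
      by (metis even_two_times_div_two odd_two_times_div_two_succ)
  qed
  then have "distinct ?vs"
    by (simp only: distinct_map distinct_upt set_upt)
  moreover have "alternating_edges ?vs = edges (orbit \<sigma> i)"
    using closed \<open>0 < k\<close> by (intro alternating_edges_walk[of _ k]) (auto simp del: upt_Suc mult_Suc_right)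
  moreover have "edges (orbit \<sigma> i) \<subseteq> edges S"
    using permutes_orbit_subset[OF permutes assms] by (auto simp: edges_def)
  ultimately show ?thesis
    unfolding alternating_cycles_def
    by (intro CollectI conjI exI[of _ ?vs]) (auto simp: k_def)
qed

text \<open>The start forces the whole walk, because each vertex lies on only one edge of each
  colour.\<close>

lemma alternating_walk_from_L:
  assumes sub: "alternating_edges vs \<subseteq> edges S"
    and len: "length vs = 2 * k" "0 < k" and start: "vs ! 0 = L i"
  shows "i \<in> S \<and> alternating_edges vs = edges (orbit \<sigma> i)"
proof -
  have black: "j \<in> S \<and> vs ! (2 * m + 1) = R (\<sigma> j)" if "m < k" "vs ! (2 * m) = L j" for m j
    using in_alternating_edges(1)[OF that(1) len(1)] sub that(2)
    by (auto simp: Black_in_edges doubleton_L dest!: subsetD)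
  have grey: "vs ! ((2 * m + 2) mod (2 * k)) = L j" if "m < k" "vs ! (2 * m + 1) = R j" for m j
    using in_alternating_edges(2)[OF that(1) len(1)] sub that(2)
    by (auto simp: Grey_in_edges doubleton_R dest!: subsetD)
  have walk: "vs ! (2 * m) = L ((\<sigma> ^^ m) i) \<and> vs ! (2 * m + 1) = R ((\<sigma> ^^ Suc m) i)" if "m < k" for m
    using that
  proof (induction m)
    case 0
    then show ?case using black[of 0 i] start by simp
  next
    case (Suc m)
    then have "vs ! ((2 * m + 2) mod (2 * k)) = L ((\<sigma> ^^ Suc m) i)"
      by (intro grey) auto
    then have "vs ! (2 * Suc m) = L ((\<sigma> ^^ Suc m) i)"
      using Suc.prems by simp
    then show ?case using black[of "Suc m"] Suc.prems by simp
  qed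
  \<comment> \<open>The last grey edge wraps around to index 0, which shows that \<open>k\<close> is
    a period of \<open>i\<close>.\<close>
  have "vs ! ((2 * (k - 1) + 2) mod (2 * k)) = L ((\<sigma> ^^ Suc (k - 1)) i)"
    using walk[of "k - 1"] len(2) by (intro grey) auto
  moreover have "2 * (k - 1) + 2 = 2 * k" "Suc (k - 1) = k"
    using len(2) by auto
  ultimately have "(\<sigma> ^^ k) i = i"
    using start inj_L by (simp add: inj_eq)
  then show ?thesis
    using alternating_edges_walk[OF len _ walk] black[of 0 i] start len(2) by simp
qed

lemma alternating_graph_reverse: "alternating_graph R L S (inv \<sigma>)"
  using inj_L inj_R L_neq_R permutes_inv[OF permutes] finite_S
  by unfold_locales (auto simp: eq_commute)

text \<open>In the reversed graph the black edge of index \<open>\<sigma> i\<close> is the old one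
  of index \<open>i\<close>, so an invariant index set yields the same edges.\<close>

lemma edges_reverse:
  assumes "\<sigma> ` A = A"
  shows "alternating_graph.edges R L (inv \<sigma>) A = edges A"
proof -
  interpret rev: alternating_graph R L S "inv \<sigma>"
    by (rule alternating_graph_reverse)
  have "(\<lambda>i. (Black, {R i, L (inv \<sigma> i)})) ` \<sigma> ` A = (\<lambda>i. (Black, {L i, R (\<sigma> i)})) ` A"
    by (simp add: image_image permutes_inverses[OF permutes] insert_commute)
  then show ?thesis
    unfolding edges_def rev.edges_def assms by (simp add: insert_commute)
qed

text \<open>A cycle listed from a left end follows \<open>\<sigma>\<close>, one listed from a right
  end follows its inverse, and both permutations have the same orbits.\<close>

lemma alternating_cycles_edges: "alternating_cycles (edges S) = edges ` orbit \<sigma> ` S"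
proof (intro set_eqI iffI)
  fix C assume "C \<in> alternating_cycles (edges S)"
  then obtain vs where vs: "vs \<noteq> []" "even (length vs)" and C: "C = alternating_edges vs"
    and sub: "alternating_edges vs \<subseteq> edges S"
    unfolding alternating_cycles_def by auto
  define k where "k = length vs div 2"
  with vs have k: "length vs = 2 * k" "0 < k"
    by (cases vs; auto)+
  have "(Black, {vs ! 0, vs ! 1}) \<in> edges S"
    using in_alternating_edges(1)[OF k(2,1)] sub by auto
  then consider i where "vs ! 0 = L i" | i where "vs ! 0 = R i"
    by (auto simp: Black_in_edges doubleton_eq_iff)
  then show "C \<in> edges ` orbit \<sigma> ` S"
  proof cases
    case 1
    then show ?thesis
      using alternating_walk_from_L[OF sub k] C by blast
  next
    case 2
    interpret rev: alternating_graph R L S "inv \<sigma>"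
      by (rule alternating_graph_reverse)
    have "i \<in> S \<and> alternating_edges vs = rev.edges (orbit (inv \<sigma>) i)"
      using sub edges_reverse[OF permutes_image[OF permutes]] 2
      by (intro rev.alternating_walk_from_L[OF _ k]) auto
    moreover have "orbit (inv \<sigma>) i = orbit \<sigma> i"
      using permutes finite_S by (intro orbit_inv_eq) (auto simp: permutation_permutes)
    ultimately show ?thesis
      using edges_reverse[OF image_orbit] C by auto
  qed
qed (use edges_orbit_in_alternating_cycles in auto)

lemma num_cycles_edges: "num_cycles (edges S) = num_orbits S \<sigma>"
  unfolding num_cycles_def alternating_cycles_edges num_orbits_def
  using inj_edges by (intro card_image) (auto intro: inj_on_subset)

lemma num_1_cycles_edges: "num_k_cycles 1 (edges S) = card (fixed_points S \<sigma>)"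
proof -
  have card1: "card (orbit \<sigma> i) = 1 \<longleftrightarrow> \<sigma> i = i" for i
    using eq_on_cyclic_on_iff1[OF cyclic_on_orbit[OF permutes finite_S]
        permutes_self_in_orbit[OF permutes finite_S]] by metis
  have "{C \<in> alternating_cycles (edges S). cycle_length C = 1}
      = edges ` orbit \<sigma> ` fixed_points S \<sigma>"
    unfolding alternating_cycles_edges fixed_points_def using card1
    by (auto simp: cycle_length_edges)
  also have "\<dots> = (\<lambda>i. edges {i}) ` fixed_points S \<sigma>"
    unfolding image_image fixed_points_def
    by (intro image_cong) (auto simp: orbit_eq_singleton_iff[THEN iffD2])
  finally show ?thesis
    unfolding num_k_cycles_def using inj_edges
    by (auto intro!: card_image inj_onI dest: injD[OF inj_edges])
qed

end

section \<open>The permutation of the black edges\<close>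

definition shift :: "nat \<Rightarrow> nat \<Rightarrow> nat" where
  "shift n x = (if x < n then Suc x else if x = n then 0 else x)"

definition black_perm :: "nat \<Rightarrow> (nat \<Rightarrow> nat) \<Rightarrow> nat \<Rightarrow> nat" where
  "black_perm n p = inv p \<circ> inv (shift n) \<circ> p \<circ> shift n"

lemma shift_permutes: "shift n permutes {..n}"
proof (rule bij_imp_permutes)
  show "bij_betw (shift n) {..n} {..n}"
    by (rule bij_betw_byWitness[where f' = "\<lambda>x. if x = 0 then n else x - 1"])
      (auto simp: shift_def)
qed (auto simp: shift_def)

lemma shift_eq_iff: "shift n x = shift n y \<longleftrightarrow> x = y"
  using permutes_inj[OF shift_permutes] by (simp add: inj_eq)

lemma permutes_atMost:
  fixes p :: "nat \<Rightarrow> nat"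
  assumes "p permutes {1..n}"
  shows "p permutes {..n}"
  using assms by (rule permutes_subset) auto

lemma permutes_eq_iff:
  assumes "p permutes A"
  shows "p x = p y \<longleftrightarrow> x = y"
  using permutes_inj[OF assms] by (simp add: inj_eq)

lemma permutes_0:
  fixes p :: "nat \<Rightarrow> nat"
  assumes "p permutes {1..n}"
  shows "p 0 = 0"
  using assms by (rule permutes_not_in) simp

lemma black_perm_permutes:
  assumes "p permutes {1..n}"
  shows "black_perm n p permutes {..n}"
  unfolding black_perm_def using permutes_atMost[OF assms] shift_permutes
  by (intro permutes_compose permutes_inv)

text \<open>The definition freed of inverses; values of \<open>black_perm\<close> are then compared
  by injectivity of \<open>p\<close> and \<open>shift n\<close>.\<close>

lemma shift_black_perm:
  assumes "p permutes {1..n}"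
  shows "shift n (p (black_perm n p x)) = p (shift n x)"
  by (simp add: black_perm_def permutes_inverses[OF assms] permutes_inverses[OF shift_permutes])

lemma black_perm_eq_0_iff:
  assumes "p permutes {1..n}" "n \<ge> 1"
  shows "black_perm n p 0 = 0 \<longleftrightarrow> p 1 = 1"
proof -
  have "p 1 = shift n (p (black_perm n p 0))" "1 = shift n (p 0)"
    using assms(2) shift_black_perm[OF assms(1), of 0] by (auto simp: shift_def permutes_0[OF assms(1)])
  then have "p 1 = 1 \<longleftrightarrow> shift n (p (black_perm n p 0)) = shift n (p 0)"
    by simp
  then show ?thesis
    by (simp add: shift_eq_iff permutes_eq_iff[OF assms(1)])
qed

text \<open>The vertex \<open>2 * p i\<close> is the left end of black edge \<open>i\<close>. The
  vertex \<open>2 * p i + 1\<close> is its grey neighbour, not in general the right end of that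
  black edge.\<close>

lemma alternating_graph_breakpoint:
  assumes p: "p permutes {1..n}"
  shows "alternating_graph (\<lambda>i. 2 * p i) (\<lambda>i. 2 * p i + 1) {..n} (black_perm n p)"
proof
  show "2 * p i \<noteq> 2 * p j + 1" for i j
    by presburger
qed (use black_perm_permutes[OF p] in \<open>auto simp: inj_def permutes_eq_iff[OF p]\<close>)

lemma extended_even:
  assumes "p permutes {1..n}" "i \<le> n"
  shows "extended n p (2 * i) = 2 * p i"
  using assms(2) by (auto simp: extended_def permutes_0[OF assms(1)])

text \<open>For \<open>i < n\<close> the vertex is \<open>2 * p (Suc i) - 1\<close>, and the shift
  equation gives \<open>p (Suc i) = Suc (p (black_perm n p i))\<close>. For \<open>i = n\<close> the
  wrap of the shift gives the value \<open>n\<close>.\<close>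

lemma extended_odd:
  assumes p: "p permutes {1..n}" and "i \<le> n"
  shows "extended n p (2 * i + 1) = 2 * p (black_perm n p i) + 1"
proof (cases "i = n")
  case True
  have "shift n (p (black_perm n p n)) = shift n n"
    by (simp add: shift_black_perm[OF p]) (simp add: shift_def permutes_0[OF p])
  then show ?thesis
    using True by (simp add: shift_eq_iff extended_def)
next
  case False
  then have "shift n (p (black_perm n p i)) = p (Suc i)" "p (Suc i) \<in> {1..n}"
    using shift_black_perm[OF p, of i] permutes_in_image[OF p, of "Suc i"] \<open>i \<le> n\<close>
    by (auto simp: shift_def)
  then have "Suc (p (black_perm n p i)) = p (Suc i)"
    by (auto simp: shift_def split: if_splits)
  then show ?thesis
    using False \<open>i \<le> n\<close> by (simp add: extended_def)
qed

lemma breakpoint_graph_eq_edges: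
  assumes p: "p permutes {1..n}"
  shows "breakpoint_graph n p =
    alternating_graph.edges (\<lambda>i. 2 * p i) (\<lambda>i. 2 * p i + 1) (black_perm n p) {..n}"
proof -
  interpret alternating_graph "\<lambda>i. 2 * p i" "\<lambda>i. 2 * p i + 1" "{..n}" "black_perm n p"
    using p by (rule alternating_graph_breakpoint)
  have "{(Black, {extended n p (2 * i), extended n p (2 * i + 1)}) | i. i \<le> n} =
      (\<lambda>i. (Black, {extended n p (2 * i), extended n p (2 * i + 1)})) ` {..n}"
    by (simp only: setcompr_eq_image atMost_def)
  also have "\<dots> = (\<lambda>i. (Black, {2 * p i, 2 * p (black_perm n p i) + 1})) ` {..n}"
    using extended_even[OF p] extended_odd[OF p] by (intro image_cong) auto
  finally have "{(Black, {extended n p (2 * i), extended n p (2 * i + 1)}) | i. i \<le> n} = \<dots>" .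
  \<comment> \<open>Grey edges are numbered by value; as \<open>p\<close> permutes
    \<open>{..n}\<close>, they can be renumbered by position.\<close>
  moreover have "{(Grey, {2 * i, 2 * i + 1}) | i. i \<le> n} =
      (\<lambda>i. (Grey, {2 * i, 2 * i + 1})) ` p ` {..n}"
    by (simp only: setcompr_eq_image atMost_def permutes_image[OF permutes_atMost[OF p], unfolded atMost_def])
  ultimately show ?thesis
    unfolding breakpoint_graph_def edges_def image_image by simp
qed

text \<open>Twice the bound \<open>g\<close>.\<close>

definition potential :: "nat \<Rightarrow> (nat \<Rightarrow> nat) \<Rightarrow> int" where
  "potential n \<sigma> = int n + 1 + int (num_orbits {..n} \<sigma>) - 2 * int (card (fixed_points {..n} \<sigma>))
     - (if \<sigma> 0 = 0 then 0 else 2)"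

lemma g_bound_eq_potential:
  assumes p: "p permutes {1..n}" and "n \<ge> 1"
  shows "g_bound n p = real_of_int (potential n (black_perm n p)) / 2"
proof -
  interpret alternating_graph "\<lambda>i. 2 * p i" "\<lambda>i. 2 * p i + 1" "{..n}" "black_perm n p"
    using p by (rule alternating_graph_breakpoint)
  show ?thesis
    using black_perm_eq_0_iff[OF assms] num_cycles_edges num_1_cycles_edges
    unfolding g_bound_def potential_def f_term_def breakpoint_graph_eq_edges[OF p]
    by (auto simp: field_simps)
qed

section \<open>Prefix block-interchanges acting on the black edges\<close>

lemma of_one_line_permutes:
  assumes "distinct xs" "set xs = {1..length xs}"
  shows "of_one_line xs permutes {1..length xs}"
proof (rule bij_imp_permutes)
  have "inj_on (of_one_line xs) {1..length xs}"
    using assms(1) by (auto simp: inj_on_def of_one_line_def nth_eq_iff_index_eq)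
  moreover have "of_one_line xs ` {1..length xs} \<subseteq> {1..length xs}"
  proof (rule image_subsetI)
    fix x assume "x \<in> {1..length xs}"
    then show "of_one_line xs x \<in> {1..length xs}"
      using nth_mem[of "x - 1" xs] unfolding assms(2) by (cases x) (auto simp: of_one_line_def)
  qed
  ultimately show "bij_betw (of_one_line xs) {1..length xs} {1..length xs}"
    by (simp add: bij_betw_def endo_inj_surj)
qed (auto simp: of_one_line_def)

lemma prefix_block_interchange_permutes:
  assumes "1 < j" "j \<le> k" "k < l" "l \<le> n + 1"
  shows "block_interchange n 1 j k l permutes {1..n}"
proof -
  let ?xs = "[1..<1] @ [k..<l] @ [j..<k] @ [1..<j] @ [l..<n + 1]"
  have "length ?xs = n" "distinct ?xs" "set ?xs = {1..n}"
    using assms by auto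
  then show ?thesis
    using of_one_line_permutes[of ?xs] by (simp only: block_interchange_def)
qed

text \<open>The numbers \<open>a\<close>, \<open>v\<close>, \<open>u\<close> are the lengths of the
  first, middle and last block; \<open>v = 0\<close> covers the exchange of adjacent blocks.\<close>

lemma prefix_block_interchange_apply:
  assumes "a + v + u \<le> n"
  shows "block_interchange n 1 (Suc a) (Suc (a + v)) (Suc (a + v + u)) x =
    (if x = 0 \<or> a + v + u < x then x
     else if x \<le> u then x + (a + v)
     else if x \<le> v + u then x + a - u
     else x - (v + u))"
proof (cases x)
  case (Suc y)
  consider "y < u" | "u \<le> y" "y < v + u" | "v + u \<le> y" "y < a + v + u" | "a + v + u \<le> y" "y < n"
    | "n \<le> y"
    by linarith
  then show ?thesis
    by cases (use assms Suc in \<open>auto simp: block_interchange_def of_one_line_def nth_append simp del: upt_Suc\<close>)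
qed (simp add: block_interchange_def of_one_line_def)

text \<open>
  \<open>\<beta>(1, a + 1, b + 1, c + 1)\<close> cuts the black edges \<open>0\<close>, \<open>a\<close>, \<open>b\<close>, \<open>c\<close>; the transpositions
  describe which of their right ends each left end is joined to afterwards.
\<close>

lemma prefix_block_interchange_shift:
  assumes "0 < a" "a < b" "b < c" "c \<le> n"
  defines "\<beta> \<equiv> block_interchange n 1 (Suc a) (Suc b) (Suc c)"
  shows "\<beta> (shift n x) = shift n (transpose 0 b (transpose a c (\<beta> x)))"
proof -
  obtain v where v: "b = a + v" "0 < v"
    using less_imp_add_positive[OF assms(2)] by auto
  obtain u where u: "c = a + v + u" "0 < u"
    using less_imp_add_positive[OF assms(3)] v by auto
  have \<beta>: "\<beta> x = (if x = 0 \<or> a + v + u < x then x else if x \<le> u then x + (a + v)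
      else if x \<le> v + u then x + a - u else x - (v + u))" for x
    using assms(4) unfolding \<beta>_def u(1) v(1) by (rule prefix_block_interchange_apply)
  \<comment> \<open>After the exchange the blocks end at \<open>u\<close>, \<open>v + u\<close> and
    \<open>a + v + u\<close>. Together with 0 these are the only places where \<open>\<beta>\<close>
    fails to commute with the shift.\<close>
  consider "x = 0" | "0 < x" "x < u" | "x = u" | "u < x" "x < v + u" | "x = v + u"
    | "v + u < x" "x < a + v + u" | "x = a + v + u" | "a + v + u < x"
    by linarith
  then show ?thesis
    unfolding u(1) v(1)
    by cases (use assms(1,4) u v in \<open>auto simp: \<beta> shift_def transpose_def\<close>)
qed

text \<open>With an empty middle block only the edges \<open>0\<close>, \<open>b\<close>,
  \<open>c\<close> are cut, and the two transpositions compose to the 3-cycle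
  \<open>0 \<mapsto> b \<mapsto> c \<mapsto> 0\<close>.\<close>

lemma prefix_transposition_shift:
  assumes "0 < b" "b < c" "c \<le> n"
  defines "\<beta> \<equiv> block_interchange n 1 (Suc b) (Suc b) (Suc c)"
  shows "\<beta> (shift n x) = shift n (transpose 0 c (transpose 0 b (\<beta> x)))"
proof -
  obtain u where u: "c = b + u" "0 < u"
    using less_imp_add_positive[OF assms(2)] by auto
  have \<beta>: "\<beta> x = (if x = 0 \<or> b + u < x then x else if x \<le> u then x + b else x - u)" for x
    using prefix_block_interchange_apply[of b 0 u n x] assms(3) unfolding \<beta>_def u(1) by simp
  consider "x = 0" | "0 < x" "x < u" | "x = u" | "u < x" "x < b + u" | "x = b + u" | "b + u < x"
    by linarith
  then show ?thesis
    unfolding u(1)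
    by cases (use assms(1,3) u in \<open>auto simp: \<beta> shift_def transpose_def\<close>)
qed

text \<open>The hypothesis on \<open>\<beta>\<close> makes it conjugate the new permutation of black
  edges to \<open>black_perm n p \<circ> \<tau>\<close>. It also fixes 0, so every term of the
  potential agrees.\<close>

lemma potential_black_perm_comp:
  assumes p: "p permutes {1..n}" and \<beta>: "\<beta> permutes {1..n}"
    and shift: "\<And>x. \<beta> (shift n x) = shift n (\<tau> (\<beta> x))"
  shows "potential n (black_perm n (p \<circ> \<beta>)) = potential n (black_perm n p \<circ> \<tau>)"
proof -
  let ?\<sigma> = "black_perm n p" and ?\<sigma>' = "black_perm n (p \<circ> \<beta>)"
  have p\<beta>: "p \<circ> \<beta> permutes {1..n}"
    using \<beta> p by (rule permutes_compose)
  have conj: "\<beta> \<circ> ?\<sigma>' = (?\<sigma> \<circ> \<tau>) \<circ> \<beta>"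
  proof
    fix x
    have "shift n (p (\<beta> (?\<sigma>' x))) = p (shift n (\<tau> (\<beta> x)))"
      using shift_black_perm[OF p\<beta>, of x] by (simp add: shift)
    also have "\<dots> = shift n (p (?\<sigma> (\<tau> (\<beta> x))))"
      by (rule shift_black_perm[OF p, symmetric])
    finally show "(\<beta> \<circ> ?\<sigma>') x = ((?\<sigma> \<circ> \<tau>) \<circ> \<beta>) x"
      by (simp add: shift_eq_iff permutes_eq_iff[OF p])
  qed
  have "num_orbits {..n} (?\<sigma> \<circ> \<tau>) = num_orbits {..n} ?\<sigma>'"
    using black_perm_permutes[OF p\<beta>] finite_atMost permutes_atMost[OF \<beta>] conj
    by (rule num_orbits_conj)
  moreover have "card (fixed_points {..n} (?\<sigma> \<circ> \<tau>)) = card (fixed_points {..n} ?\<sigma>')"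
    using permutes_atMost[OF \<beta>] conj by (rule card_fixed_points_conj)
  moreover have "(?\<sigma> \<circ> \<tau>) 0 = \<beta> (?\<sigma>' 0)"
    using fun_cong[OF conj, of 0] by (simp add: permutes_0[OF \<beta>])
  then have "(?\<sigma> \<circ> \<tau>) 0 = 0 \<longleftrightarrow> ?\<sigma>' 0 = 0"
    using permutes_eq_iff[OF \<beta>, of "?\<sigma>' 0" 0] by (simp add: permutes_0[OF \<beta>])
  ultimately show ?thesis
    by (simp add: potential_def)
qed

section \<open>Decreasing the potential\<close>

lemma finite_fixed_points: "finite S \<Longrightarrow> finite (fixed_points S \<sigma>)"
  by (simp add: fixed_points_def)

text \<open>Two more orbits cost 2 and two new fixed points gain 4. If \<open>\<rho>\<close> fixes
  0, the lost last term costs 2 more, which 0 repays as a third new fixed point.\<close>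

lemma potential_le_minus_2:
  assumes "\<sigma> 0 \<noteq> 0" and num: "num_orbits {..n} \<rho> = num_orbits {..n} \<sigma> + 2"
    and fixed: "\<And>z. \<sigma> z = z \<Longrightarrow> \<rho> z = z"
    and new: "\<sigma> u \<noteq> u" "\<rho> u = u" "\<sigma> v \<noteq> v" "\<rho> v = v" "u \<noteq> v" "u \<in> {1..n}" "v \<in> {1..n}"
  shows "potential n \<rho> \<le> potential n \<sigma> - 2"
proof -
  define N where "N = {u, v} \<union> {z. z = 0 \<and> \<rho> 0 = 0}"
  have card_N: "card N = (if \<rho> 0 = 0 then 3 else 2)"
    using new(5-7) by (auto simp: N_def)
  have "fixed_points {..n} \<sigma> \<inter> N = {}"
    using \<open>\<sigma> 0 \<noteq> 0\<close> new by (auto simp: fixed_points_def N_def)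
  then have "card (fixed_points {..n} \<sigma>) + card N = card (fixed_points {..n} \<sigma> \<union> N)"
    by (intro card_Un_disjoint[symmetric] finite_fixed_points) (auto simp: N_def)
  also have "\<dots> \<le> card (fixed_points {..n} \<rho>)"
    using fixed new by (intro card_mono finite_fixed_points) (auto simp: fixed_points_def N_def)
  finally show ?thesis
    using card_N num \<open>\<sigma> 0 \<noteq> 0\<close> by (auto simp: potential_def split: if_splits)
qed

text \<open>The first transposition isolates \<open>b\<close>, the second isolates \<open>y\<close>,
  each adding an orbit. The case \<open>x = 0\<close> is allowed.\<close>

lemma potential_split_twice:
  assumes \<sigma>: "\<sigma> permutes {..n}" "\<sigma> 0 \<noteq> 0" and b: "\<sigma> 0 = b"
    and xy: "(\<sigma> \<circ> transpose 0 b) x = y" "x \<noteq> y" "x \<noteq> b" "y \<noteq> b" "y \<noteq> 0" "x \<le> n"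
  shows "potential n (\<sigma> \<circ> transpose 0 b \<circ> transpose x y) \<le> potential n \<sigma> - 2"
proof -
  define \<sigma>1 where "\<sigma>1 = \<sigma> \<circ> transpose 0 b"
  define \<sigma>2 where "\<sigma>2 = \<sigma>1 \<circ> transpose x y"
  have inj: "\<sigma> u = \<sigma> v \<longleftrightarrow> u = v" for u v
    using \<sigma>(1) by (rule permutes_eq_iff)
  have "b \<noteq> 0" "b \<le> n"
    using permutes_in_image[OF \<sigma>(1), of 0] b \<sigma>(2) by auto
  then have \<sigma>1: "\<sigma>1 permutes {..n}"
    unfolding \<sigma>1_def by (intro permutes_compose permutes_swap_id \<sigma>(1)) auto
  have \<sigma>1_0: "\<sigma>1 0 = \<sigma> b" and \<sigma>1_b: "\<sigma>1 b = b"
    and \<sigma>1_eq: "\<And>z. z \<noteq> 0 \<Longrightarrow> z \<noteq> b \<Longrightarrow> \<sigma>1 z = \<sigma> z"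
    using b by (auto simp: \<sigma>1_def)
  have x: "\<sigma>1 x = y"
    using xy(1) by (simp add: \<sigma>1_def)
  have "y \<le> n"
    using permutes_in_image[OF \<sigma>1, of x] x xy(6) by simp
  have \<sigma>2_y: "\<sigma>2 y = y" and \<sigma>2_eq: "\<And>z. z \<noteq> x \<Longrightarrow> z \<noteq> y \<Longrightarrow> \<sigma>2 z = \<sigma>1 z"
    using x by (auto simp: \<sigma>2_def)
  \<comment> \<open>All points touched by the transpositions are moved by \<open>\<sigma>\<close>,
    so no old fixed point is lost.\<close>
  have neq: "\<sigma> b \<noteq> b" "\<sigma> x \<noteq> x" "\<sigma> y \<noteq> y"
  proof -
    show "\<sigma> b \<noteq> b"
      using inj[of b 0] b \<open>b \<noteq> 0\<close> by simp
    show "\<sigma> x \<noteq> x"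
      using \<sigma>1_eq[of x] x xy(2,3) \<sigma>(2) by (cases "x = 0") auto
    show "\<sigma> y \<noteq> y"
      using permutes_eq_iff[OF \<sigma>1, of y x] \<sigma>1_eq[of y] x xy(2,4,5) by auto
  qed
  have "num_orbits {..n} \<sigma>1 = Suc (num_orbits {..n} \<sigma>)"
    unfolding \<sigma>1_def using \<sigma>(1) b \<open>b \<noteq> 0\<close> by (intro num_orbits_split) auto
  moreover have "num_orbits {..n} \<sigma>2 = Suc (num_orbits {..n} \<sigma>1)"
    unfolding \<sigma>2_def using \<sigma>1 x xy(2,6) by (intro num_orbits_split) auto
  ultimately have num: "num_orbits {..n} \<sigma>2 = num_orbits {..n} \<sigma> + 2"
    by simp
  have "potential n \<sigma>2 \<le> potential n \<sigma> - 2"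
  proof (rule potential_le_minus_2[OF \<sigma>(2) num])
    show "\<sigma>2 z = z" if "\<sigma> z = z" for z
    proof -
      have "z \<noteq> 0" "z \<noteq> b" "z \<noteq> x" "z \<noteq> y"
        using that neq \<sigma>(2) by (cases "z = 0"; auto)+
      then show ?thesis
        using \<sigma>2_eq[of z] \<sigma>1_eq[of z] that by simp
    qed
    show "\<sigma>2 b = b"
      using \<sigma>2_eq[of b] \<sigma>1_b xy(3,4) by simp
  qed (use neq \<sigma>2_y xy(4,5) \<open>b \<noteq> 0\<close> \<open>b \<le> n\<close> \<open>y \<le> n\<close> in auto)
  then show ?thesis
    by (simp only: \<sigma>1_def \<sigma>2_def)
qed

text \<open>The number of orbits is unchanged and \<open>b\<close> replaces 0 as a fixed point; the
  gain of 2 comes from 0 no longer being fixed.\<close>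

lemma potential_merge:
  assumes \<sigma>: "\<sigma> permutes {..n}" "\<sigma> 0 = 0" and bc: "\<sigma> c = b" "b \<noteq> c" "b \<noteq> 0" "c \<le> n"
  shows "potential n (\<sigma> \<circ> transpose 0 c \<circ> transpose 0 b) \<le> potential n \<sigma> - 2"
proof -
  define \<sigma>1 where "\<sigma>1 = \<sigma> \<circ> transpose c b"
  define \<sigma>2 where "\<sigma>2 = \<sigma> \<circ> transpose 0 c \<circ> transpose 0 b"
  have inj: "\<sigma> u = \<sigma> v \<longleftrightarrow> u = v" for u v
    using \<sigma>(1) by (rule permutes_eq_iff)
  have "c \<noteq> 0"
    using \<sigma>(2) bc(1,3) by (cases "c = 0") auto
  have "b \<le> n"
    using permutes_in_image[OF \<sigma>(1), of c] bc by simp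
  then have \<sigma>2: "\<sigma>2 permutes {..n}"
    unfolding \<sigma>2_def using \<open>c \<le> n\<close> by (intro permutes_compose permutes_swap_id \<sigma>(1)) auto
  have \<sigma>2_0: "\<sigma>2 0 = \<sigma> b" and \<sigma>2_b: "\<sigma>2 b = b" and \<sigma>2_c: "\<sigma>2 c = 0"
    and \<sigma>2_eq: "\<And>z. z \<noteq> 0 \<Longrightarrow> z \<noteq> b \<Longrightarrow> z \<noteq> c \<Longrightarrow> \<sigma>2 z = \<sigma> z"
    using \<sigma>(2) bc(1-3) \<open>c \<noteq> 0\<close> by (simp_all add: \<sigma>2_def transpose_def)
  have b_neq: "\<sigma> b \<noteq> b" "\<sigma> b \<noteq> 0"
    using inj[of b c] inj[of b 0] bc(1-3) \<sigma>(2) by auto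
  \<comment> \<open>Splitting 0 off \<open>\<sigma>2\<close> and splitting \<open>b\<close> off
    \<open>\<sigma>\<close> give the same permutation, so \<open>\<sigma>2\<close> and
    \<open>\<sigma>\<close> have equally many orbits.\<close>
  have "(\<sigma>2 \<circ> transpose c 0) z = \<sigma>1 z" for z
    using bc(1-3) \<open>c \<noteq> 0\<close> \<sigma>(2) \<sigma>2_0 \<sigma>2_b \<sigma>2_c \<sigma>2_eq[of z]
    by (simp add: \<sigma>1_def transpose_def)
  then have "\<sigma>2 \<circ> transpose c 0 = \<sigma>1" ..
  moreover have "num_orbits {..n} \<sigma>1 = Suc (num_orbits {..n} \<sigma>)"
    unfolding \<sigma>1_def using \<sigma>(1) bc by (intro num_orbits_split) auto
  moreover have "num_orbits {..n} (\<sigma>2 \<circ> transpose c 0) = Suc (num_orbits {..n} \<sigma>2)"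
    using \<sigma>2 \<sigma>2_c \<open>c \<noteq> 0\<close> \<open>c \<le> n\<close> by (intro num_orbits_split) auto
  ultimately have num: "num_orbits {..n} \<sigma>2 = num_orbits {..n} \<sigma>"
    by simp
  have "insert b (fixed_points {..n} \<sigma> - {0}) \<subseteq> fixed_points {..n} \<sigma>2"
  proof
    fix z assume z: "z \<in> insert b (fixed_points {..n} \<sigma> - {0})"
    show "z \<in> fixed_points {..n} \<sigma>2"
    proof (cases "z = b")
      case True
      then show ?thesis using \<sigma>2_b \<open>b \<le> n\<close> by (simp add: fixed_points_def)
    next
      case False
      then have "z \<le> n" "\<sigma> z = z" "z \<noteq> 0" "z \<noteq> c"
        using z bc(1,2) by (auto simp: fixed_points_def)
      then show ?thesis using \<sigma>2_eq[of z] False by (simp add: fixed_points_def)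
    qed
  qed
  then have "card (insert b (fixed_points {..n} \<sigma> - {0})) \<le> card (fixed_points {..n} \<sigma>2)"
    by (intro card_mono finite_fixed_points) auto
  moreover have "card (insert b (fixed_points {..n} \<sigma> - {0})) = card (fixed_points {..n} \<sigma>)"
  proof -
    have "0 \<in> fixed_points {..n} \<sigma>" "b \<notin> fixed_points {..n} \<sigma>"
      using \<sigma>(2) b_neq by (auto simp: fixed_points_def)
    moreover have "finite (fixed_points {..n} \<sigma>)"
      by (simp add: finite_fixed_points)
    ultimately show ?thesis
      using card_Suc_Diff1[of "fixed_points {..n} \<sigma>" 0] by simp
  qed
  ultimately show ?thesis
    using num \<sigma>(2) \<sigma>2_0 b_neq(2) unfolding \<sigma>2_def[symmetric] by (simp add: potential_def)
qed

section \<open>Existence of a decreasing move\<close>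

lemma shift_image_neq:
  assumes "A \<subseteq> {1..n}" "A \<noteq> {}"
  shows "shift n ` A \<noteq> A"
proof
  assume eq: "shift n ` A = A"
  have fin: "finite A"
    using assms(1) finite_subset by blast
  then have "Max A \<in> A"
    using assms(2) by simp
  then have "shift n (Max A) \<in> A"
    using eq by blast
  \<comment> \<open>The shift sends the maximum to its successor or to 0, and neither lies in
    \<open>A\<close>.\<close>
  then have "shift n (Max A) \<le> Max A" "shift n (Max A) \<noteq> 0"
    using fin assms(1) by auto
  moreover have "Max A \<le> n"
    using \<open>Max A \<in> A\<close> assms(1) by auto
  ultimately show False
    by (auto simp: shift_def split: if_splits)
qed

text \<open>
  Otherwise \<open>\<sigma>\<close> would permute \<open>{1..<b}\<close>, so that \<open>p ` {1..b}\<close> would be closed under the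
  cyclic shift.
\<close>

lemma black_perm_crossing:
  assumes p: "p permutes {1..n}" and b: "black_perm n p 0 = b" "b \<noteq> 0"
  shows "black_perm n p b \<in> {1..<b} \<or>
    (\<exists>x y. black_perm n p x = y \<and> y \<in> {1..<b} \<and> b < x \<and> x \<le> n)"
proof (rule ccontr)
  let ?\<sigma> = "black_perm n p"
  assume *: "\<not> ?thesis"
  note \<sigma> = black_perm_permutes[OF p]
  have "b \<le> n"
    using permutes_in_image[OF \<sigma>, of 0] b by simp
  \<comment> \<open>The preimage is not 0, whose image is \<open>b\<close>; the negated claim
    excludes \<open>b\<close> and everything above it.\<close>
  have pre: "inv ?\<sigma> y \<in> {1..<b}" if y: "y \<in> {1..<b}" for y
  proof -
    have x: "?\<sigma> (inv ?\<sigma> y) = y"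
      by (rule permutes_inverses(1)[OF \<sigma>])
    have "inv ?\<sigma> y \<le> n"
      using permutes_in_image[OF permutes_inv[OF \<sigma>], of y] y \<open>b \<le> n\<close> by simp
    moreover have "inv ?\<sigma> y \<noteq> 0"
      using x y b(1) by (cases "inv ?\<sigma> y = 0") auto
    moreover have "inv ?\<sigma> y \<noteq> b"
      using x y * by (cases "inv ?\<sigma> y = b") auto
    ultimately show ?thesis
      using * x y by (cases "b < inv ?\<sigma> y") auto
  qed
  have "inv ?\<sigma> ` {1..<b} = {1..<b}"
    using pre permutes_inj_on[OF permutes_inv[OF \<sigma>]] by (intro endo_inj_surj) auto
  then have "?\<sigma> ` {1..<b} = ?\<sigma> ` inv ?\<sigma> ` {1..<b}"
    by simp
  also have "\<dots> = {1..<b}"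
    by (simp add: image_image permutes_inverses[OF \<sigma>])
  finally have img: "?\<sigma> ` {1..<b} = {1..<b}" .
  have "{..<b} = insert 0 {1..<b}" "{1..b} = insert b {1..<b}"
    using b(2) by auto
  then have \<sigma>_img: "?\<sigma> ` {..<b} = {1..b}"
    using img b(1) by simp
  have "{1..b} = Suc ` {..<b}"
    by (simp add: image_Suc_lessThan)
  also have "\<dots> = shift n ` {..<b}"
    using \<open>b \<le> n\<close> by (intro image_cong) (auto simp: shift_def)
  finally have "p ` {1..b} = (\<lambda>x. p (shift n x)) ` {..<b}"
    by (simp add: image_image)
  also have "\<dots> = shift n ` p ` ?\<sigma> ` {..<b}"
    by (simp add: image_image shift_black_perm[OF p])
  finally have "shift n ` p ` {1..b} = p ` {1..b}"
    by (simp add: \<sigma>_img)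
  moreover have "p ` {1..b} \<subseteq> {1..n}"
    using permutes_image[OF p] \<open>b \<le> n\<close> by (metis atLeastatMost_subset_iff image_mono order_refl)
  ultimately show False
    using shift_image_neq[of "p ` {1..b}" n] b(2) by simp
qed

text \<open>Then \<open>p\<close> commutes with the shift, and it fixes 0.\<close>

lemma black_perm_eq_id:
  assumes p: "p permutes {1..n}" and "black_perm n p = id"
  shows "p = id"
proof
  fix x
  have "p x = x" if "x \<le> n"
    using that
  proof (induction x)
    case (Suc x)
    then have "shift n x = Suc x"
      by (simp add: shift_def)
    then show ?case
      using Suc shift_black_perm[OF p, of x] assms(2) by simp
  qed (rule permutes_0[OF p])
  then show "p x = id x"
    using permutes_not_in[OF p, of x] by (cases "x \<le> n") auto
qed

lemma potential_step:
  assumes p: "p permutes {1..n}" and "p \<noteq> id"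
  shows "\<exists>\<beta>. is_prefix_block_interchange n \<beta> \<and> p \<circ> \<beta> permutes {1..n} \<and>
    potential n (black_perm n (p \<circ> \<beta>)) \<le> potential n (black_perm n p) - 2"
proof -
  let ?\<sigma> = "black_perm n p"
  note \<sigma> = black_perm_permutes[OF p]
  have four: ?thesis
    if "0 < a" "a < b" "b < c" "c \<le> n"
      "potential n (?\<sigma> \<circ> transpose 0 b \<circ> transpose a c) \<le> potential n ?\<sigma> - 2" for a b c
  proof -
    let ?\<beta> = "block_interchange n 1 (Suc a) (Suc b) (Suc c)"
    have \<beta>: "?\<beta> permutes {1..n}"
      using that by (intro prefix_block_interchange_permutes) auto
    have "potential n (black_perm n (p \<circ> ?\<beta>)) = potential n (?\<sigma> \<circ> (transpose 0 b \<circ> transpose a c))"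
      using prefix_block_interchange_shift[OF that(1-4)]
      by (intro potential_black_perm_comp[OF p \<beta>]) simp
    moreover have "is_prefix_block_interchange n ?\<beta>"
      unfolding is_block_interchange_def using that
      by (intro exI[of _ "Suc a"] exI[of _ "Suc b"] exI[of _ "Suc c"]) auto
    ultimately show ?thesis
      using that(5) permutes_compose[OF \<beta> p] by (auto simp: comp_assoc)
  qed
  have three: ?thesis
    if "0 < b" "b < c" "c \<le> n"
      "potential n (?\<sigma> \<circ> transpose 0 c \<circ> transpose 0 b) \<le> potential n ?\<sigma> - 2" for b c
  proof -
    let ?\<beta> = "block_interchange n 1 (Suc b) (Suc b) (Suc c)"
    have \<beta>: "?\<beta> permutes {1..n}"
      using that by (intro prefix_block_interchange_permutes) auto
    have "potential n (black_perm n (p \<circ> ?\<beta>)) = potential n (?\<sigma> \<circ> (transpose 0 c \<circ> transpose 0 b))"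
      using prefix_transposition_shift[OF that(1-3)]
      by (intro potential_black_perm_comp[OF p \<beta>]) simp
    moreover have "is_prefix_block_interchange n ?\<beta>"
      unfolding is_block_interchange_def using that
      by (intro exI[of _ "Suc b"] exI[of _ "Suc b"] exI[of _ "Suc c"]) auto
    ultimately show ?thesis
      using that(4) permutes_compose[OF \<beta> p] by (auto simp: comp_assoc)
  qed
  show ?thesis
  proof (cases "?\<sigma> 0 = 0")
    case True
    have "?\<sigma> \<noteq> id"
      using black_perm_eq_id[OF p] \<open>p \<noteq> id\<close> by blast
    \<comment> \<open>A permutation of \<open>{..n}\<close> that lowers no point is the
      identity.\<close>
    then obtain c where c: "c \<le> n" "?\<sigma> c < c"
      using permutes_natset_ge[OF \<sigma>] by (meson atMost_iff not_le)
    moreover have "?\<sigma> c \<noteq> 0"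
      using permutes_eq_iff[OF \<sigma>, of c 0] True c by auto
    ultimately show ?thesis
      using potential_merge[OF \<sigma> True refl, of c] by (intro three[of "?\<sigma> c" c]) auto
  next
    case False
    define b where "b = ?\<sigma> 0"
    have b: "?\<sigma> 0 = b" "b \<noteq> 0"
      using False by (auto simp: b_def)
    have "b \<le> n"
      using permutes_in_image[OF \<sigma>, of 0] b by simp
    from black_perm_crossing[OF p b] consider "?\<sigma> b \<in> {1..<b}"
      | x where "?\<sigma> x \<in> {1..<b}" "b < x" "x \<le> n"
      by blast
    then show ?thesis
    proof cases
      case 1
      \<comment> \<open>After the first split the image of 0 is \<open>?\<sigma> b\<close>, so the
        second split is taken at \<open>x = 0\<close>. The product is the 3-cycle move with cuts
        \<open>?\<sigma> b < b\<close>.\<close>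
      then show ?thesis
        using potential_split_twice[OF \<sigma> False b(1), of 0 "?\<sigma> b"] b \<open>b \<le> n\<close>
        by (intro three[of "?\<sigma> b" b]) auto
    next
      case 2
      then have "potential n (?\<sigma> \<circ> transpose 0 b \<circ> transpose x (?\<sigma> x)) \<le> potential n ?\<sigma> - 2"
        by (intro potential_split_twice[OF \<sigma> False b(1)]) auto
      with 2 show ?thesis
        by (intro four[of "?\<sigma> x" b x]) (auto simp: transpose_commute)
    qed
  qed
qed

section \<open>Sorting by repeated moves\<close>

lemma potential_id: "potential n id = 0"
proof -
  have "orbit id x = {x}" for x :: nat
    by (simp add: orbit_eq_singleton_iff)
  then have "num_orbits {..n} id = n + 1"
    by (simp add: num_orbits_def card_image)
  moreover have "fixed_points {..n} id = {..n}"
    by (auto simp: fixed_points_def)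
  ultimately show ?thesis
    by (simp add: potential_def)
qed

text \<open>A crude lower bound that turns the shifted potential into a natural-number induction
  measure.\<close>

lemma potential_ge: "- int n - 3 \<le> potential n \<sigma>"
proof -
  have "card (fixed_points {..n} \<sigma>) \<le> card {..n}"
    by (rule card_mono) (auto simp: fixed_points_def)
  then show ?thesis
    by (simp add: potential_def)
qed

text \<open>Each move is paid for by a drop of 2 in the potential, which is 0 at the
  identity.\<close>

lemma ex_sorts_potential:
  assumes "p permutes {1..n}"
  shows "\<exists>bs. sorts n p bs \<and> 2 * int (length bs) \<le> potential n (black_perm n p)"
  using assms
proof (induction "nat (potential n (black_perm n p) + int n + 3)" arbitrary: p rule: less_induct)
  case less
  show ?case
  proof (cases "p = id")
    case True
    have "black_perm n id = id"
      using permutes_inv_o(2)[OF shift_permutes] by (simp add: black_perm_def)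
    then show ?thesis
      using True potential_id by (intro exI[of _ "[]"]) (simp add: sorts_def)
  next
    case False
    then obtain \<beta> where \<beta>: "is_prefix_block_interchange n \<beta>" "p \<circ> \<beta> permutes {1..n}"
      "potential n (black_perm n (p \<circ> \<beta>)) \<le> potential n (black_perm n p) - 2"
      using potential_step[OF less.prems] by blast
    have "\<exists>bs. sorts n (p \<circ> \<beta>) bs \<and>
        2 * int (length bs) \<le> potential n (black_perm n (p \<circ> \<beta>))"
      using \<beta>(3) potential_ge[of n "black_perm n (p \<circ> \<beta>)"] by (intro less.hyps \<beta>(2)) linarith
    then obtain bs where "sorts n (p \<circ> \<beta>) bs"
      "2 * int (length bs) \<le> potential n (black_perm n (p \<circ> \<beta>))"
      by blast
    then show ?thesis
      using \<beta> by (intro exI[of _ "\<beta> # bs"]) (simp add: sorts_def)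
  qed
qed

theorem theorem3p4:
  fixes n :: nat and \<pi> :: "nat \<Rightarrow> nat"
  assumes "n \<ge> 1"
    and "\<pi> permutes {1..n}"
  shows "real (pbid n \<pi>) \<le> g_bound n \<pi>"
proof -
  obtain bs where bs: "sorts n \<pi> bs"
    "2 * int (length bs) \<le> potential n (black_perm n \<pi>)"
    using ex_sorts_potential[OF assms(2)] by blast
  have "pbid n \<pi> \<le> length bs"
    unfolding pbid_def using bs(1) by (intro Least_le) blast
  then show ?thesis
    using bs(2) by (simp add: g_bound_eq_potential[OF assms(2,1)])
qed

end
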